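(* Let $r>1$. The range $\{s_{-r}(n):n\in\mathbb{N}\}$ of $s_{-r}$ is dense in the interval $\left(\frac{1}{\zeta(r)},1\right]$ if and only if $s_{-r}(p_m^2)\geq\prod_{i=m+1}^{\infty}s_{-r}(p_i)$ for all positive integers $m$.
   Context: For a real number $t$, $s_t$ denotes the multiplicative arithmetic function defined by $s_t(p^{\alpha})=\sum_{j=0}^{\alpha}(-p^t)^j$ for all primes $p$ and positive integers $\alpha$. $p_i$ denotes the $i$-th prime number and $\zeta$ is the Riemann zeta function. *)

theory Defs
  imports "HOL-Analysis.Analysis" "HOL-Computational_Algebra.Primes" "HOL-Library.Infinite_Set"
begin

text \<open>
  The multiplicative function with \<open>s\<^sub>t(p\<^sup>\<alpha>) = (\<Sum>j\<le>\<alpha>. (- p\<^sup>t)\<^sup>j)\<close>, given by its Euler-type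
  factorisation. Lemmas \<open>s_prime_power\<close>, \<open>s_one\<close> and \<open>s_mult_coprime\<close> below are the defining
  properties; they determine the values at positive arguments. The value at 0 is irrelevant.
\<close>
definition s :: "real \<Rightarrow> nat \<Rightarrow> real" where
  "s t n = (\<Prod>p\<in>prime_factors n. \<Sum>j\<le>multiplicity p n. (- (real p powr t)) ^ j)"

text \<open>Indexing starts at 1, so \<open>nth_prime 1 = 2\<close>; the value at 0 is irrelevant.\<close>
definition nth_prime :: "nat \<Rightarrow> nat" where
  "nth_prime i = enumerate {p. prime p} (i - 1)"

text \<open>The Riemann zeta function by its Dirichlet series, so only meaningful for \<open>r > 1\<close>.\<close>
definition zeta :: "real \<Rightarrow> real" where
  "zeta r = (\<Sum>n. 1 / real (Suc n) powr r)"

lemma s_one: "s t 1 = 1"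
  by (simp add: s_def)

lemma s_prime_power:
  assumes "prime p" "\<alpha> > 0"
  shows "s t (p ^ \<alpha>) = (\<Sum>j=0..\<alpha>. (- (real p powr t)) ^ j)"
proof -
  have "prime_factors (p ^ \<alpha>) = {p}"
    using assms by (simp add: prime_factorization_prime_power)
  moreover have "multiplicity p (p ^ \<alpha>) = \<alpha>"
    using assms by simp
  ultimately show ?thesis
    by (simp add: s_def atMost_atLeast0)
qed

lemma s_mult_coprime:
  assumes "a > 0" "b > 0" "coprime a b"
  shows "s t (a * b) = s t a * s t b"
proof -
  let ?f = "\<lambda>n p. \<Sum>j\<le>multiplicity p n. (- (real p powr t)) ^ j"
  have disj: "prime_factors a \<inter> prime_factors b = {}"
    using assms(3) by (auto simp: in_prime_factors_iff dest: coprime_common_divisor_nat)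
  have mult: "multiplicity p (a * b) = multiplicity p a + multiplicity p b"
    if "prime p" for p
    using assms that by (intro prime_elem_multiplicity_mult_distrib) auto
  have "s t (a * b) = prod (?f (a * b)) (prime_factors a \<union> prime_factors b)"
    using assms by (simp add: s_def prime_factors_product)
  also have "\<dots> = prod (?f (a * b)) (prime_factors a) * prod (?f (a * b)) (prime_factors b)"
    using disj by (intro prod.union_disjoint) auto
  also have "prod (?f (a * b)) (prime_factors a) = s t a"
    unfolding s_def
  proof (rule prod.cong[OF refl])
    fix p assume p: "p \<in> prime_factors a"
    hence "\<not> p dvd b"
      using disj assms by (auto simp: in_prime_factors_iff disjoint_iff)
    hence "multiplicity p b = 0"
      by (rule not_dvd_imp_multiplicity_0)
    thus "?f (a * b) p = ?f a p" using mult p by (simp add: in_prime_factors_iff)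
  qed
  also have "prod (?f (a * b)) (prime_factors b) = s t b"
    unfolding s_def
  proof (rule prod.cong[OF refl])
    fix p assume p: "p \<in> prime_factors b"
    hence "\<not> p dvd a"
      using disj assms by (auto simp: in_prime_factors_iff disjoint_iff)
    hence "multiplicity p a = 0"
      by (rule not_dvd_imp_multiplicity_0)
    thus "?f (a * b) p = ?f b p" using mult p by (simp add: in_prime_factors_iff)
  qed
  finally show ?thesis .
qed

end

theory Submission
  imports Defs
begin

text \<open>
  Put \<open>x\<^sub>i = p\<^sub>i\<^sup>-\<^sup>r \<le> 1/2\<close>. The prime \<open>p\<^sub>i\<close> contributes to \<open>s\<^sub>-\<^sub>r(n)\<close> a factor \<open>1\<close>, or one between
  \<open>1 - x\<^sub>i = s\<^sub>-\<^sub>r(p\<^sub>i)\<close> and \<open>1 - x\<^sub>i + x\<^sub>i\<^sup>2 = s\<^sub>-\<^sub>r(p\<^sub>i\<^sup>2)\<close>. Let \<open>P\<^sub>m\<close> be the product of \<open>1 - x\<^sub>i\<close> over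
  \<open>i > m\<close>; the Euler product gives \<open>P\<^sub>0 = 1/\<zeta>(r)\<close>. If \<open>s\<^sub>-\<^sub>r(p\<^sub>m\<^sup>2) < P\<^sub>m\<close>, no value lies strictly between
  the two: \<open>s\<^sub>-\<^sub>r(n) \<le> s\<^sub>-\<^sub>r(p\<^sub>m\<^sup>2)\<close> if one of the first \<open>m\<close> primes divides \<open>n\<close>, and \<open>s\<^sub>-\<^sub>r(n) \<ge> P\<^sub>m\<close>
  otherwise. Conversely, if \<open>s\<^sub>-\<^sub>r(p\<^sub>m\<^sup>2) \<ge> P\<^sub>m\<close> for all \<open>m\<close>, a target in \<open>[P\<^sub>0, 1]\<close> can be divided
  successively by values at powers of \<open>p\<^sub>1, p\<^sub>2, \<dots>\<close> so that after \<open>m\<close> steps it lies in \<open>[P\<^sub>m, 1]\<close>.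
  Since \<open>P\<^sub>m\<close> tends to 1, the products of the divisors tend to the target.
\<close>

section \<open>Local factors as alternating geometric sums\<close>

text \<open>The local factor of \<open>s t\<close> at a prime \<open>p\<close> with exponent
  \<open>a\<close>, where \<open>x\<close> stands for \<open>real p powr t\<close>. A free real
  \<open>x\<close> turns the estimates into polynomial inequalities.\<close>

definition alt_geom :: "real \<Rightarrow> nat \<Rightarrow> real" where
  "alt_geom x a = (\<Sum>j\<le>a. (- x) ^ j)"

lemma alt_geom_simps [simp]:
  "alt_geom x 0 = 1"
  "alt_geom x 1 = 1 - x"
  "alt_geom x (Suc 0) = 1 - x"
  "alt_geom x 2 = 1 - x + x\<^sup>2"
  "alt_geom x 3 = 1 - x + x\<^sup>2 - x ^ 3"
  by (simp_all add: alt_geom_def numeral_2_eq_2 numeral_3_eq_3)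

lemma alt_geom_closed_form: "(1 + x) * alt_geom x a = 1 - (- x) ^ Suc a"
  using sum_gp_basic[of "- x" a] by (simp add: alt_geom_def)

lemma neg_power_le:
  fixes x :: real
  assumes "0 \<le> x" "x \<le> 1" "m \<le> n"
  shows "(- x) ^ n \<le> x ^ m" "- ((- x) ^ n) \<le> x ^ m"
proof -
  have "\<bar>(- x) ^ n\<bar> \<le> x ^ m"
    using assms by (simp add: power_abs power_decreasing)
  thus "(- x) ^ n \<le> x ^ m" "- ((- x) ^ n) \<le> x ^ m" by linarith+
qed

text \<open>After multiplication by \<open>1 + x\<close> the closed form leaves only
  \<open>(- x) ^ Suc a\<close> to estimate, and for \<open>a > 0\<close> this is at most
  \<open>x^2\<close>.\<close>

lemma alt_geom_lower:
  assumes "0 < x" "x \<le> 1"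
  shows "1 - x \<le> alt_geom x a"
proof (cases a)
  case (Suc b)
  have "(1 + x) * (1 - x) = 1 - x\<^sup>2"
    by (simp add: algebra_simps power2_eq_square)
  also have "\<dots> \<le> (1 + x) * alt_geom x a"
    using neg_power_le(1)[of x 2 "Suc a"] assms Suc
    unfolding alt_geom_closed_form by linarith
  finally have "(1 + x) * (1 - x) \<le> (1 + x) * alt_geom x a" .
  then show ?thesis using assms by simp
qed (use assms in simp)

text \<open>For \<open>a \<ge> 2\<close> the closed form deviates upwards from 1 by at most
  \<open>x ^ 3\<close>, and \<open>1 + x ^ 3\<close> factors as
  \<open>(1 + x) * (1 - x + x^2)\<close>.\<close>

lemma alt_geom_upper:
  assumes "0 < x" "x \<le> 1" "a > 0"
  shows "alt_geom x a \<le> 1 - x + x\<^sup>2"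
proof (cases "a = 1")
  case False
  have "(1 + x) * alt_geom x a \<le> 1 + x ^ 3"
    using neg_power_le(2)[of x 3 "Suc a"] assms False
    unfolding alt_geom_closed_form by linarith
  also have "\<dots> = (1 + x) * (1 - x + x\<^sup>2)"
    by (simp add: algebra_simps power2_eq_square power3_eq_cube)
  finally have "(1 + x) * alt_geom x a \<le> (1 + x) * (1 - x + x\<^sup>2)" .
  then show ?thesis using assms by simp
qed simp

lemma alt_geom_le_1:
  assumes "0 < x" "x \<le> 1"
  shows "alt_geom x a \<le> 1"
proof (cases "a = 0")
  case False
  have "x\<^sup>2 \<le> x" using assms by (simp add: power2_eq_square mult_left_le)
  then show ?thesis using alt_geom_upper[of x a] assms False by simp
qed simp

lemma alt_geom_pos:
  assumes "0 < x" "x < 1"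
  shows "0 < alt_geom x a"
  using alt_geom_lower[of x a] assms by linarith

text \<open>
  The exponents 0, 2, 3, 1 list values of \<open>alt_geom x\<close> in decreasing order, consecutive ones
  having ratio at least \<open>1 - x + x\<^sup>2\<close>, so the intervals \<open>[P * alt_geom x a, alt_geom x a]\<close>
  overlap and cover \<open>[(1 - x) * P, 1]\<close>.
\<close>
lemma alt_geom_cover:
  assumes x: "0 < x" "x \<le> 1 / 2" and P: "0 < P" "P \<le> 1 - x + x\<^sup>2"
    and y: "(1 - x) * P \<le> y" "y \<le> 1"
  shows "\<exists>a. P * alt_geom x a \<le> y \<and> y \<le> alt_geom x a"
proof -
  define g2 g3 where "g2 = 1 - x + x\<^sup>2" and "g3 = 1 - x + x\<^sup>2 - x ^ 3"
  have x32: "x ^ 3 \<le> x\<^sup>2"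
    using x by (simp add: power_decreasing)
  \<comment> \<open>The overlaps amount to \<open>g2 * g2 \<le> g3\<close> and
    \<open>g2 * g3 \<le> 1 - x\<close>. After cancelling \<open>1 - x\<close> in the second, both
    reduce to the sign of the same polynomial, which is nonpositive because
    \<open>x \<le> 1 / 2\<close>.\<close>
  have fac: "g3 = (1 - x) * (1 + x\<^sup>2)"
    by (simp add: g3_def algebra_simps power2_eq_square power3_eq_cube)
  have sq: "g2 * (1 + x\<^sup>2) - 1 = x * (2 * x - 1 + x ^ 3 - x\<^sup>2)"
    by (simp add: g2_def algebra_simps power2_eq_square power3_eq_cube)
  have "x * (2 * x - 1 + x ^ 3 - x\<^sup>2) \<le> 0"
    using x x32 by (intro mult_nonneg_nonpos) linarith+
  hence key: "g2 * (1 + x\<^sup>2) \<le> 1" using sq by linarith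
  have "g2 * g2 - g3 = x * (2 * x - 1 + x ^ 3 - x\<^sup>2)"
    by (simp add: g2_def g3_def algebra_simps power2_eq_square power3_eq_cube)
  hence g22: "g2 * g2 \<le> g3" using sq key by linarith
  have "(1 - x) * (g2 * (1 + x\<^sup>2)) \<le> (1 - x) * 1"
    using key x by (intro mult_left_mono) auto
  hence g23: "g2 * g3 \<le> 1 - x" by (simp add: fac algebra_simps)
  have pos: "0 < g2" "0 < g3"
    using x by (auto simp: fac g2_def intro!: add_pos_nonneg mult_pos_pos)
  have Pg2: "P \<le> g2" using P by (simp add: g2_def)
  have P2: "P * g2 \<le> g3"
    using mult_right_mono[OF Pg2, of g2] pos g22 by linarith
  have P3: "P * g3 \<le> 1 - x"
    using mult_right_mono[OF Pg2, of g3] pos g23 by linarith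
  have g: "alt_geom x 2 = g2" "alt_geom x 3 = g3" by (simp_all add: g2_def g3_def)
  consider "P * 1 \<le> y" "y \<le> 1" | "P * g2 \<le> y" "y \<le> g2"
    | "P * g3 \<le> y" "y \<le> g3" | "P * (1 - x) \<le> y" "y \<le> 1 - x"
    using y P2 P3 Pg2 by (simp add: mult.commute) linarith
  thus ?thesis
    by cases (metis g alt_geom_simps(1,2))+
qed

section \<open>Tails of infinite products and the greedy expansion\<close>

lemma prodinf_split_first:
  fixes f :: "nat \<Rightarrow> real"
  assumes "convergent_prod f" "\<And>i. f i \<noteq> 0"
  shows "(\<Prod>i. f (i + k)) = f k * (\<Prod>i. f (i + Suc k))"
  using prodinf_split_initial_segment[of "\<lambda>i. f (i + k)" 1] assms
  by (simp add: convergent_prod_ignore_initial_segment mult.commute)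

text \<open>A tail is the full product divided by a partial product, and the partial products tend
  to the full product, which is nonzero.\<close>

lemma prodinf_tail_tendsto_1:
  fixes f :: "nat \<Rightarrow> real"
  assumes "convergent_prod f" "\<And>i. f i \<noteq> 0"
  shows "(\<lambda>k. \<Prod>i. f (i + k)) \<longlonglongrightarrow> 1"
proof -
  have nz: "prodinf f \<noteq> 0"
    using assms by (simp add: prodinf_nonzero)
  have "(\<lambda>k. prod f {..<k}) \<longlonglongrightarrow> prodinf f"
    using convergent_prod_LIMSEQ[OF assms(1)]
    by (subst filterlim_sequentially_Suc[symmetric]) (simp add: lessThan_Suc_atMost)
  hence "(\<lambda>k. prodinf f / prod f {..<k}) \<longlonglongrightarrow> prodinf f / prodinf f"
    using nz by (intro tendsto_intros)
  moreover have "(\<Prod>i. f (i + k)) = prodinf f / prod f {..<k}" for k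
    using assms by (intro prodinf_divide_initial_segment) auto
  ultimately show ?thesis using nz by simp
qed

lemma greedy_expansion:
  fixes x :: "nat \<Rightarrow> real"
  assumes x: "\<And>i. 0 < x i" "\<And>i. x i \<le> 1 / 2"
    and conv: "convergent_prod (\<lambda>i. 1 - x i)"
    and dom: "\<And>k. (\<Prod>i. 1 - x (i + Suc k)) \<le> alt_geom (x k) 2"
    and y: "(\<Prod>i. 1 - x i) \<le> y" "y \<le> 1"
  obtains a where "(\<lambda>n. \<Prod>i<n. alt_geom (x i) (a i)) \<longlonglongrightarrow> y"
proof -
  define P where "P k = (\<Prod>i. 1 - x (i + k))" for k
  have x1: "x i < 1" for i using x(2)[of i] by simp
  have nz: "1 - x i \<noteq> 0" for i using x1[of i] by simp
  have P_step: "P k = (1 - x k) * P (Suc k)" for k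
    unfolding P_def using prodinf_split_first[OF conv nz] by simp
  have P_pos: "P k > 0" for k
    unfolding P_def using conv x1
    by (intro less_0_prodinf convergent_prod_ignore_initial_segment[OF conv]) auto
  have P_lim: "P \<longlonglongrightarrow> 1"
    unfolding P_def by (rule prodinf_tail_tendsto_1[OF conv nz])
  \<comment> \<open>The sequence to be chosen records what remains of the target after
    \<open>n\<close> divisions; the clause for \<open>n = 0\<close> pins its start to
    \<open>y\<close>.\<close>
  let ?inv = "\<lambda>n z. P n \<le> z \<and> z \<le> 1 \<and> (n = 0 \<longrightarrow> z = y)"
  let ?step = "\<lambda>n z z'. \<exists>a. z = z' * alt_geom (x n) a"
  have "\<exists>Y. \<forall>n. ?inv n (Y n) \<and> ?step n (Y n) (Y (Suc n))"
  proof (rule dependent_nat_choice)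
    show "\<exists>z. ?inv 0 z" using y by (auto simp: P_def)
  next
    fix z n assume z: "?inv n z"
    \<comment> \<open>Since \<open>P n = (1 - x n) * P (Suc n)\<close>, the invariant is what the
      covering lemma assumes. Its conclusion puts the quotient of \<open>z\<close> by the chosen
      factor into \<open>[P (Suc n), 1]\<close>.\<close>
    obtain a where a: "P (Suc n) * alt_geom (x n) a \<le> z" "z \<le> alt_geom (x n) a"
      using alt_geom_cover[of "x n" "P (Suc n)" z] x[of n] P_pos[of "Suc n"] dom[of n] z P_step[of n]
      by (auto simp: P_def)
    have "alt_geom (x n) a > 0" using x x1 by (intro alt_geom_pos)
    thus "\<exists>z'. ?inv (Suc n) z' \<and> ?step n z z'"
      using a by (intro exI[of _ "z / alt_geom (x n) a"]) (auto simp: field_simps)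
  qed
  then obtain Y where Y: "\<And>n. P n \<le> Y n" "\<And>n. Y n \<le> 1" "Y 0 = y"
    and "\<forall>n. \<exists>a. Y n = Y (Suc n) * alt_geom (x n) a"
    by blast
  then obtain a where a: "\<And>n. Y n = Y (Suc n) * alt_geom (x n) (a n)" by metis
  have prod: "y = Y n * (\<Prod>i<n. alt_geom (x i) (a i))" for n
  proof (induction n)
    case (Suc n)
    thus ?case by (subst (asm) a) (simp add: mult_ac)
  qed (use Y(3) in simp)
  have "Y \<longlonglongrightarrow> 1"
    by (rule tendsto_sandwich[OF _ _ P_lim tendsto_const]) (use Y in auto)
  hence "(\<lambda>n. y / Y n) \<longlonglongrightarrow> y / 1" by (intro tendsto_intros) auto
  moreover have "Y n \<noteq> 0" for n using Y(1)[of n] P_pos[of n] by linarith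
  hence "y / Y n = (\<Prod>i<n. alt_geom (x i) (a i))" for n
    using prod[of n] by (simp add: field_simps)
  ultimately show thesis using that[of a] by simp
qed

section \<open>Enumeration of the primes and values of \<open>s\<close>\<close>

text \<open>Index 0 is no exception: \<open>0 - 1 = 0\<close> on naturals, so
  \<open>nth_prime 0\<close> is 2 as well. The indices \<open>Suc i\<close> list every prime exactly
  once.\<close>

lemma prime_nth_prime: "prime (nth_prime i)"
  using enumerate_in_set[OF primes_infinite] by (simp add: nth_prime_def)

lemma nth_prime_Suc_less_iff: "nth_prime (Suc i) < nth_prime (Suc j) \<longleftrightarrow> i < j"
  by (simp add: nth_prime_def primes_infinite)

lemma nth_prime_Suc_eq_iff: "nth_prime (Suc i) = nth_prime (Suc j) \<longleftrightarrow> i = j"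
  using nth_prime_Suc_less_iff[of i j] nth_prime_Suc_less_iff[of j i] by auto

lemma le_nth_prime_Suc: "i \<le> nth_prime (Suc i)"
  by (simp add: nth_prime_def le_enumerate primes_infinite)

lemma prime_eq_nth_prime:
  assumes "prime p"
  obtains i where "p = nth_prime (Suc i)"
  using enumerate_Ex[OF primes_infinite, of p] assms by (auto simp: nth_prime_def)

lemma s_prime_power_alt_geom:
  assumes "prime p"
  shows "s t (p ^ a) = alt_geom (real p powr t) a"
proof (cases "a = 0")
  case True
  thus ?thesis using s_one by simp
next
  case False
  thus ?thesis using s_prime_power[OF assms, of a t] by (simp add: alt_geom_def atMost_atLeast0)
qed

lemma s_alt_geom:
  "s t n = (\<Prod>p\<in>prime_factors n. alt_geom (real p powr t) (multiplicity p n))"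
  by (simp add: s_def alt_geom_def)

text \<open>Realises the partial products of the greedy expansion as values of \<open>s\<close>:
  powers of distinct primes are coprime, so multiplicativity applies factor by factor.\<close>

lemma s_prod_nth_primes:
  "s t (\<Prod>i<n. nth_prime (Suc i) ^ a i)
    = (\<Prod>i<n. alt_geom (real (nth_prime (Suc i)) powr t) (a i))"
proof (induction n)
  case (Suc n)
  let ?N = "\<Prod>i<n. nth_prime (Suc i) ^ a i"
  have "coprime ?N (nth_prime (Suc n) ^ a n)"
    by (intro prod_coprime_left coprime_power_left_iff[THEN iffD2]
          coprime_power_right_iff[THEN iffD2] disjI1)
       (auto intro!: primes_coprime simp: prime_nth_prime nth_prime_Suc_eq_iff)
  moreover have "?N > 0" by (intro prod_pos) (auto simp: prime_gt_0_nat prime_nth_prime)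
  ultimately show ?case
    using Suc by (simp add: s_mult_coprime s_prime_power_alt_geom prime_nth_prime prime_gt_0_nat)
qed (use s_one in simp)

section \<open>The Euler product of zeta\<close>

text \<open>Unordered summation lets the zeta series be split and reindexed over arbitrary sets of
  integers, as the sieve requires.\<close>

lemma summable_on_powr:
  assumes "r > 1"
  shows "(\<lambda>n. real n powr (- r)) summable_on A"
proof (rule summable_on_subset)
  show "(\<lambda>n. real n powr (- r)) summable_on UNIV"
    using assms by (subst summable_on_UNIV_nonneg_real_iff) (auto simp: summable_real_powr_iff)
qed simp

lemma zeta_eq_infsum:
  assumes "r > 1"
  shows "zeta r = (\<Sum>\<^sub>\<infinity>n. real n powr (- r))"
proof -
  have sm: "summable (\<lambda>n. real n powr (- r))"
    using assms by (simp add: summable_real_powr_iff)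
  have "(\<Sum>\<^sub>\<infinity>n. real n powr (- r)) = (\<Sum>n. real n powr (- r))"
    using has_sum_imp_sums[OF has_sum_infsum[OF summable_on_powr[OF assms]]]
    by (simp add: sums_iff)
  \<comment> \<open>\<open>0 powr (- r)\<close> is 0, so dropping the index 0 does not change the
    sum.\<close>
  also have "\<dots> = (\<Sum>n. real (Suc n) powr (- r))"
    using suminf_split_head[OF sm] by simp
  finally show ?thesis by (simp add: zeta_def powr_minus divide_inverse)
qed

text \<open>
  Passing from \<open>k\<close> to \<open>k + 1\<close> removes the terms at the multiples of \<open>p = nth_prime (k + 1)\<close>, which
  sum to \<open>p\<^sup>-\<^sup>r\<close> times the current series.
\<close>
lemma infsum_sieve:
  fixes r :: real
  assumes r: "r > 1"
  shows "(\<Sum>\<^sub>\<infinity>n | \<forall>i<k. \<not> nth_prime (Suc i) dvd n. real n powr (- r))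
    = zeta r * (\<Prod>i<k. 1 - real (nth_prime (Suc i)) powr (- r))"
proof (induction k)
  case 0
  thus ?case by (simp add: zeta_eq_infsum[OF r])
next
  case (Suc k)
  let ?f = "\<lambda>n. real n powr (- r)" and ?q = "nth_prime (Suc k)"
  define A where "A k = {n. \<forall>i<k. \<not> nth_prime (Suc i) dvd n}" for k
  \<comment> \<open>Multiplying by \<open>?q\<close> creates no divisibility by an earlier prime, so
    the multiples of \<open>?q\<close> in \<open>A k\<close> are exactly \<open>?q\<close> times the
    elements of \<open>A k\<close>.\<close>
  have dvd: "nth_prime (Suc i) dvd ?q * m \<longleftrightarrow> nth_prime (Suc i) dvd m" if "i < k" for i m
    using that
    by (auto simp: prime_dvd_mult_iff prime_nth_prime nth_prime_Suc_eq_iff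
             dest!: primes_dvd_imp_eq[rotated 2])
  have "A k = A (Suc k) \<union> (*) ?q ` A k"
  proof (intro equalityI subsetI)
    fix n assume n: "n \<in> A k"
    show "n \<in> A (Suc k) \<union> (*) ?q ` A k"
    proof (cases "?q dvd n")
      case True
      then obtain m where m: "n = ?q * m" by (elim dvdE)
      hence "m \<in> A k" using n dvd by (auto simp: A_def)
      thus ?thesis using m by auto
    qed (use n in \<open>auto simp: A_def less_Suc_eq\<close>)
  next
    fix n assume "n \<in> A (Suc k) \<union> (*) ?q ` A k"
    thus "n \<in> A k" using dvd by (auto simp: A_def)
  qed
  moreover have "A (Suc k) \<inter> (*) ?q ` A k = {}" by (auto simp: A_def)
  ultimately have "infsum ?f (A k) = infsum ?f (A (Suc k)) + infsum ?f ((*) ?q ` A k)"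
    using infsum_Un_disjoint[OF summable_on_powr[OF r] summable_on_powr[OF r]] by metis
  also have "infsum ?f ((*) ?q ` A k) = infsum (?f \<circ> (*) ?q) (A k)"
    by (intro infsum_reindex inj_onI) (use prime_gt_0_nat[OF prime_nth_prime, of "Suc k"] in auto)
  also have "\<dots> = ?f ?q * infsum ?f (A k)"
    by (simp add: o_def powr_mult infsum_cmult_right')
  finally show ?case using Suc by (simp add: A_def algebra_simps)
qed

text \<open>The partial product times \<open>zeta r\<close> is the sum over the integers surviving
  \<open>k\<close> sieve steps. It contains the term 1 at \<open>n = 1\<close>, and every other
  survivor is at least \<open>k\<close>, so the remainder is bounded by a tail of a convergent
  series.\<close>

lemma euler_product_tendsto:
  fixes r :: real
  assumes r: "r > 1"
  shows "(\<lambda>k. \<Prod>i<k. 1 - real (nth_prime (Suc i)) powr (- r)) \<longlonglongrightarrow> 1 / zeta r"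
    and "zeta r \<ge> 1"
proof -
  let ?f = "\<lambda>n. real n powr (- r)"
  define A where "A k = {n. \<forall>i<k. \<not> nth_prime (Suc i) dvd n}" for k
  have sm: "summable ?f" using r by (simp add: summable_real_powr_iff)
  have mono: "infsum ?f B \<le> infsum ?f C" if "B \<subseteq> C" for B C
    using that by (intro infsum_mono2 summable_on_powr[OF r]) auto
  have one: "1 \<in> A k" for k
    using prime_nth_prime not_prime_unit unfolding A_def by blast
  have lower: "1 \<le> infsum ?f (A k)" for k
    using mono[of "{1}" "A k"] one by simp
  have tail: "infsum ?f {k..} = (\<Sum>n. ?f (n + k))" for k
  proof -
    have "infsum ?f {k..} = infsum (\<lambda>n. ?f (n + k)) UNIV"
      by (rule infsum_reindex_bij_witness[of _ "\<lambda>n. n + k" "\<lambda>n. n - k"]) auto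
    moreover have "(\<lambda>n. ?f (n + k)) summable_on UNIV"
      using summable_ignore_initial_segment[OF sm, of k]
      by (subst summable_on_UNIV_nonneg_real_iff) auto
    ultimately show ?thesis
      using has_sum_imp_sums[OF has_sum_infsum] by (metis sums_unique)
  qed
  \<comment> \<open>Taking 1 out of \<open>{k..}\<close> keeps the union disjoint also for
    \<open>k \<le> 1\<close>.\<close>
  have subset: "A k \<subseteq> {1} \<union> ({k..} - {1})" for k
  proof
    fix n assume n: "n \<in> A k"
    show "n \<in> {1} \<union> ({k..} - {1})"
    proof (cases "n = 1 \<or> n = 0")
      case True
      \<comment> \<open>Every prime divides 0, so 0 survives only before the first sieve
        step.\<close>
      moreover have "k = 0" if "n = 0" using n that by (auto simp: A_def)
      ultimately show ?thesis by auto
    next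
      case False
      then obtain p where p: "prime p" "p dvd n" using prime_factor_nat[of n] by auto
      then obtain i where i: "p = nth_prime (Suc i)" by (metis prime_eq_nth_prime)
      hence "k \<le> i" using n p(2) unfolding A_def by (metis leI mem_Collect_eq)
      also have "i \<le> p" using i le_nth_prime_Suc by simp
      also have "p \<le> n" using p False by (simp add: dvd_imp_le)
      finally show ?thesis by auto
    qed
  qed
  have upper: "infsum ?f (A k) \<le> 1 + (\<Sum>n. ?f (n + k))" for k
  proof -
    have "infsum ?f (A k) \<le> infsum ?f ({1} \<union> ({k..} - {1}))"
      by (rule mono[OF subset])
    also have "\<dots> = infsum ?f {1} + infsum ?f ({k..} - {1})"
      by (rule infsum_Un_disjoint) (auto intro: summable_on_powr[OF r])
    also have "\<dots> \<le> 1 + infsum ?f {k..}" using mono[of "{k..} - {1}" "{k..}"] by auto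
    finally show ?thesis using tail by simp
  qed
  have "(\<lambda>k. \<Sum>n. ?f (n + k)) \<longlonglongrightarrow> 0" by (rule suminf_exist_split2[OF sm])
  hence lim: "(\<lambda>k. 1 + (\<Sum>n. ?f (n + k))) \<longlonglongrightarrow> 1" using tendsto_add[OF tendsto_const] by fastforce
  have "(\<lambda>k. infsum ?f (A k)) \<longlonglongrightarrow> 1"
    by (rule tendsto_sandwich[OF _ _ tendsto_const lim]) (use lower upper in auto)
  moreover show z: "zeta r \<ge> 1" using lower[of 0] zeta_eq_infsum[OF r] by (simp add: A_def)
  ultimately show "(\<lambda>k. \<Prod>i<k. 1 - real (nth_prime (Suc i)) powr (- r)) \<longlonglongrightarrow> 1 / zeta r"
    using tendsto_divide[of "\<lambda>k. infsum ?f (A k)" 1 sequentially "\<lambda>_. zeta r" "zeta r"]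
    unfolding A_def infsum_sieve[OF r] by simp
qed

lemma nth_prime_powr_bounds:
  fixes r :: real
  assumes "r > 1"
  shows "0 < real (nth_prime i) powr (- r)" "real (nth_prime i) powr (- r) \<le> 1 / 2"
proof -
  have "2 \<le> nth_prime i" using prime_ge_2_nat prime_nth_prime by blast
  thus "0 < real (nth_prime i) powr (- r)" by simp
  have "real (nth_prime i) powr (- r) \<le> real (nth_prime i) powr (- 1)"
    using assms \<open>2 \<le> nth_prime i\<close> by (intro powr_mono) auto
  also have "\<dots> \<le> 1 / 2" using \<open>2 \<le> nth_prime i\<close> by (simp add: powr_minus field_simps)
  finally show "real (nth_prime i) powr (- r) \<le> 1 / 2" .
qed

lemma euler_product:
  fixes r :: real
  assumes r: "r > 1"
  shows "convergent_prod (\<lambda>i. 1 - real (nth_prime (Suc i)) powr (- r))"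
    and "(\<Prod>i. 1 - real (nth_prime (Suc i)) powr (- r)) = 1 / zeta r"
proof -
  let ?u = "\<lambda>i. 1 - real (nth_prime (Suc i)) powr (- r)"
  have nz: "?u i \<noteq> 0" for i using nth_prime_powr_bounds(2)[OF r, of "Suc i"] by simp
  have lim: "(\<lambda>n. prod ?u {..n}) \<longlonglongrightarrow> 1 / zeta r"
    using LIMSEQ_Suc[OF euler_product_tendsto(1)[OF r]] by (simp add: lessThan_Suc_atMost)
  \<comment> \<open>For nonzero factors, \<open>convergent_prod\<close> means that the partial
    products have a nonzero limit.\<close>
  moreover have "1 / zeta r \<noteq> 0" using euler_product_tendsto(2)[OF r] by simp
  ultimately show conv: "convergent_prod ?u"
    using nz convergent_prod_iff_nz_lim[of ?u] by blast
  show "prodinf ?u = 1 / zeta r"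
    using LIMSEQ_unique[OF convergent_prod_LIMSEQ[OF conv] lim] .
qed

section \<open>Gaps in the range\<close>

text \<open>All factors lie in \<open>(0, 1]\<close>, so adjoining the missing indices from
  \<open>k\<close> onwards can only decrease the product.\<close>

lemma prod_subset_ge_prodinf:
  fixes u :: "nat \<Rightarrow> real"
  assumes u: "\<And>i. 0 < u i" "\<And>i. u i \<le> 1" and conv: "convergent_prod u"
    and J: "finite J" "J \<subseteq> {k..}"
  shows "(\<Prod>i. u (i + k)) \<le> prod u J"
proof -
  obtain K where K: "J \<subseteq> {..<K}" using finite_nat_bounded[OF J(1)] by blast
  have "(\<Prod>i. u (i + k)) \<le> (\<Prod>i<K. u (i + k))"
    using u by (intro prod_ge_prodinf[OF convergent_prod_has_prod])
      (auto simp: conv intro: less_imp_le)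
  also have "\<dots> = prod u {k..<K + k}"
    by (intro prod.reindex_bij_witness[of _ "\<lambda>i. i - k" "\<lambda>i. i + k"]) auto
  also have "\<dots> = prod u ({k..<K + k} - J) * prod u J"
    using J K by (intro prod.subset_diff) (auto simp: subset_iff)
  also have "\<dots> \<le> 1 * prod u J"
    using u by (intro mult_right_mono prod_le_1 prod_nonneg) (auto intro: less_imp_le)
  finally show ?thesis by simp
qed

lemma s_neg_gap:
  fixes r :: real
  assumes r: "r > 1" and n: "n > 0"
  shows "s (- r) n \<le> s (- r) ((nth_prime (Suc k))\<^sup>2)
    \<or> (\<Prod>i. s (- r) (nth_prime (Suc (i + Suc k)))) \<le> s (- r) n"
proof -
  let ?x = "\<lambda>i. real (nth_prime (Suc i)) powr (- r)"
  let ?g = "\<lambda>p. alt_geom (real p powr (- r)) (multiplicity p n)"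
  note x = nth_prime_powr_bounds[OF r]
  have x1: "real (nth_prime i) powr (- r) < 1" for i using x(2)[of i] by simp
  have s_prime: "s (- r) (nth_prime i) = 1 - real (nth_prime i) powr (- r)" for i
    using s_prime_power_alt_geom[OF prime_nth_prime, of "- r" i 1] by simp
  have g: "0 < ?g p" "?g p \<le> 1" if p: "p \<in> prime_factors n" for p
  proof -
    obtain i where "p = nth_prime (Suc i)" using p by (metis in_prime_factors_iff prime_eq_nth_prime)
    thus "0 < ?g p" "?g p \<le> 1"
      using x[of "Suc i"] x1[of "Suc i"] by (auto intro: alt_geom_pos alt_geom_le_1)
  qed
  show ?thesis
  proof (cases "\<exists>i\<le>k. nth_prime (Suc i) dvd n")
    case True
    then obtain i where i: "i \<le> k" "nth_prime (Suc i) dvd n" by blast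
    let ?p = "nth_prime (Suc i)"
    have p: "?p \<in> prime_factors n"
      using i n prime_nth_prime by (auto simp: in_prime_factors_iff)
    \<comment> \<open>The other local factors are at most 1, so a single divisor among the first
      \<open>k + 1\<close> primes already forces the upper bound.\<close>
    have "s (- r) n = ?g ?p * prod ?g (prime_factors n - {?p})"
      unfolding s_alt_geom using p by (intro prod.remove) auto
    also have "\<dots> \<le> ?g ?p * 1"
      using g p by (intro mult_left_mono prod_le_1) (auto intro: less_imp_le)
    also have "?g ?p \<le> 1 - ?x i + (?x i)\<^sup>2"
      using x[of "Suc i"] x1[of "Suc i"] p
      by (simp, intro alt_geom_upper) (auto simp: prime_factors_multiplicity)
    \<comment> \<open>\<open>1 - t + t^2\<close> decreases for \<open>t \<le> 1 / 2\<close> and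
      larger primes have smaller \<open>t\<close>, so among the first \<open>k + 1\<close> primes
      the bound is largest at index \<open>k\<close>.\<close>
    also have "\<dots> \<le> 1 - ?x k + (?x k)\<^sup>2"
    proof -
      have "nth_prime (Suc i) \<le> nth_prime (Suc k)"
        using i nth_prime_Suc_less_iff[of k i] by linarith
      hence le: "?x k \<le> ?x i"
        using r prime_gt_0_nat[OF prime_nth_prime, of "Suc i"] by (intro powr_mono2') auto
      have "(1 - ?x k + (?x k)\<^sup>2) - (1 - ?x i + (?x i)\<^sup>2) = (?x i - ?x k) * (1 - ?x i - ?x k)"
        by (simp add: algebra_simps power2_eq_square)
      moreover have "0 \<le> (?x i - ?x k) * (1 - ?x i - ?x k)"
        using le x(2)[of "Suc i"] x(2)[of "Suc k"] by (intro mult_nonneg_nonneg) auto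
      ultimately show ?thesis by linarith
    qed
    finally show ?thesis by (simp add: s_prime_power_alt_geom prime_nth_prime)
  next
    case False
    \<comment> \<open>Now every prime divisor has index beyond \<open>k\<close>. Lowering each local
      factor to \<open>1 - ?x i\<close> and adjoining the absent primes leads down to the tail
      product.\<close>
    define J where "J = {i. nth_prime (Suc i) \<in> prime_factors n}"
    have inj: "inj_on (\<lambda>i. nth_prime (Suc i)) A" for A
      by (auto simp: inj_on_def nth_prime_Suc_eq_iff)
    have img: "prime_factors n = (\<lambda>i. nth_prime (Suc i)) ` J"
      unfolding J_def by (auto simp: image_iff) (metis in_prime_factors_iff prime_eq_nth_prime)
    have "finite J" using finite_imageD[OF _ inj] img by (metis finite_set_mset)
    moreover have "J \<subseteq> {Suc k..}"
      using False by (auto simp: J_def not_less_eq_eq)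
    ultimately have "(\<Prod>i. 1 - ?x (i + Suc k)) \<le> (\<Prod>i\<in>J. 1 - ?x i)"
      using x x1 by (intro prod_subset_ge_prodinf euler_product(1)[OF r]) auto
    also have "\<dots> \<le> (\<Prod>i\<in>J. ?g (nth_prime (Suc i)))"
      using x x1 by (intro prod_mono conjI alt_geom_lower) (auto intro: less_imp_le)
    also have "\<dots> = s (- r) n"
      unfolding s_alt_geom img by (subst prod.reindex[OF inj]) simp
    finally show ?thesis by (simp add: s_prime)
  qed
qed

section \<open>Equivalence of density and the tail inequalities\<close>

theorem theorem2p2:
  fixes r :: real
  assumes "r > 1"
  shows "{1 / zeta r <.. 1} \<subseteq> closure {s (-r) n | n. n > 0} \<longleftrightarrow>
    (\<forall>m::nat. m > 0 \<longrightarrow>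
      s (-r) ((nth_prime m)\<^sup>2) \<ge> (\<Prod>i. s (-r) (nth_prime (m + 1 + i))))"
proof -
  let ?R = "{s (-r) n | n. n > 0}"
  \<comment> \<open>Indices are shifted to start at 0: \<open>x i\<close> belongs to the prime
    numbered \<open>i + 1\<close>, \<open>P k\<close> is the tail beyond the first \<open>k\<close>
    primes, and \<open>m\<close> becomes \<open>Suc k\<close>.\<close>
  define x where "x i = real (nth_prime (Suc i)) powr (- r)" for i
  define P where "P k = (\<Prod>i. 1 - x (i + k))" for k
  have x: "0 < x i" "x i \<le> 1 / 2" "x i < 1" for i
    using nth_prime_powr_bounds[OF assms, of "Suc i"] by (auto simp: x_def)
  have conv: "convergent_prod (\<lambda>i. 1 - x i)" and P0: "P 0 = 1 / zeta r"
    using euler_product[OF assms] by (simp_all add: x_def P_def)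
  have s_prime: "s (- r) (nth_prime (Suc i)) = 1 - x i" for i
    using s_prime_power_alt_geom[OF prime_nth_prime, of "- r" "Suc i" 1] by (simp add: x_def)
  have s_sq: "s (- r) ((nth_prime (Suc k))\<^sup>2) = alt_geom (x k) 2" for k
    using s_prime_power_alt_geom[OF prime_nth_prime] by (simp add: x_def)
  have s_tail: "(\<Prod>i. s (-r) (nth_prime (Suc k + 1 + i))) = P (Suc k)" for k
    using s_prime by (simp add: P_def add.commute)
  have "(\<forall>m>0. s (-r) ((nth_prime m)\<^sup>2) \<ge> (\<Prod>i. s (-r) (nth_prime (m + 1 + i))))
      \<longleftrightarrow> (\<forall>k. P (Suc k) \<le> alt_geom (x k) 2)"
    unfolding s_sq[symmetric] s_tail[symmetric] by (metis gr0_conv_Suc zero_less_Suc)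
  also have "\<dots> \<longleftrightarrow> {1 / zeta r <.. 1} \<subseteq> closure ?R"
  proof (intro iffI subsetI)
    fix y assume dom: "\<forall>k. P (Suc k) \<le> alt_geom (x k) 2" and y: "y \<in> {1 / zeta r <.. 1}"
    obtain a where lim: "(\<lambda>n. \<Prod>i<n. alt_geom (x i) (a i)) \<longlonglongrightarrow> y"
      by (rule greedy_expansion[of x y])
        (use x conv dom y P0 in \<open>auto simp: P_def simp del: alt_geom_simps\<close>)
    have "(\<Prod>i<n. alt_geom (x i) (a i)) \<in> ?R" for n
      unfolding x_def s_prod_nth_primes[symmetric]
      using prime_gt_0_nat[OF prime_nth_prime] by (blast intro: prod_pos zero_less_power)
    with lim show "y \<in> closure ?R" unfolding closure_sequential by (intro exI conjI allI)
  next
    assume closure: "{1 / zeta r <.. 1} \<subseteq> closure ?R"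
    show "\<forall>k. P (Suc k) \<le> alt_geom (x k) 2"
    proof (rule allI, rule ccontr)
      fix k assume neg: "\<not> P (Suc k) \<le> alt_geom (x k) 2"
      \<comment> \<open>The gap is open, so if it meets the closure of \<open>?R\<close> it meets
        \<open>?R\<close> itself.\<close>
      let ?U = "{alt_geom (x k) 2 <..< P (Suc k)}"
      have nz: "1 - x i \<noteq> 0" for i using x(3)[of i] by simp
      have tail_le_1: "P j \<le> 1" for j
        using prod_subset_ge_prodinf[OF _ _ conv, of "{}" j] x
        by (auto simp: P_def intro: less_imp_le)
      \<comment> \<open>Density can be applied only if the gap lies above \<open>1 / zeta r\<close>,
        which is \<open>P 0\<close>. The factor \<open>1 - x k\<close> occurs in \<open>P 0\<close>
        and the others are at most 1, hence
        \<open>P 0 \<le> 1 - x k < alt_geom (x k) 2\<close>.\<close>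
      have "P 0 = P (Suc k) * ((\<Prod>i<k. 1 - x i) * (1 - x k))"
        using prodinf_split_initial_segment[OF conv, of "Suc k"] nz by (simp add: P_def)
      also have "\<dots> \<le> 1 * (1 * (1 - x k))"
        using x tail_le_1 neg alt_geom_pos[OF x(1,3)[of k], of 2]
        by (intro mult_mono mult_right_mono prod_le_1 mult_nonneg_nonneg prod_nonneg)
          (auto intro: less_imp_le)
      also have "\<dots> < alt_geom (x k) 2" using x(1)[of k] by simp
      finally have "?U \<subseteq> {1 / zeta r <.. 1}" using P0 tail_le_1[of "Suc k"] by auto
      moreover obtain y where y: "y \<in> ?U" using neg dense[of "alt_geom (x k) 2" "P (Suc k)"] by auto
      ultimately have "y \<in> closure ?R" using closure by blast
      moreover have "open ?U" by simp
      ultimately obtain n where "n > 0" "s (- r) n \<in> ?U"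
        using y open_Int_closure_eq_empty[of ?U ?R] by blast
      thus False
        using s_neg_gap[OF assms, of n k] s_sq[of k] s_tail[of k] by (auto simp: add.commute)
    qed
  qed
  finally show ?thesis by blast
qed

end
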